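(* Thompson's group $F$ is autostackable. Moreover, with $A=\{x^{\pm1},y^{\pm1}\}$, the following set $R\subseteq A^*\times A^*$ (rules written $u\to v$) is a bounded regular convergent prefix-rewriting system for $F$: \begin{eqnarray*} R &=& \bigcup_{a \in A} \left\{uaa^{-1} \to u \mid u \in A^*\right\}\\ &&\cup \bigcup_{\epsilon\in\{1,-1\}} \bigcup_{i \in \{1,2\}}\left\{uy^\epsilon x^iy \to ux^{i}yx^{-i-1}y^{\epsilon}x^{i+1} \mid uy^\epsilon x^i \in \mathcal N\right\}\\ &&\cup \bigcup_{\epsilon\in\{1,-1\}} \bigcup_{i \in \{2,3\}}\left\{uy^\epsilon x^iy^{-1} \to ux^{i}y^{-1}x^{-i+1}y^{\epsilon}x^{i-1} \mid uy^\epsilon x^i \in \mathcal N\right\}\\ &&\cup \left\{uxy \to uy^{-1}xyx^{-2}yx^2 \mid u \in \mathcal N \cap (A^*y^{\pm 1}A^*x^2)\right\}\\ &&\cup \left\{ux^2y^{-1} \to u y^{-1}x^2y^{-1}x^{-1}yx \mid u \in \mathcal N \cap (A^*y^{\pm 1}A^*x^2)\right\}. \end{eqnarray*}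
   Context: Thompson's group $F$ is given by the presentation $F=\langle x,y \mid [y,xyx^{-2}],[y,x^2yx^{-3}]\rangle$, and $A=\{x^{\pm1},y^{\pm1}\}$; $A^*$ is the set of all finite words over $A$. The set $\mathcal N\subseteq A^*$ is the set of all words over $A$ that contain no subword of the form $aa^{-1}$ ($a\in A$), nor $y^\epsilon x^i y$, nor $y^\epsilon x^{i+1}y^{-1}$, for any $\epsilon\in\{1,-1\}$ and integer $i\ge 1$. For a set $S$ of words, $A^*y^{\pm1}A^*x^2$ denotes the set of words of the form $w_1 y^{\delta} w_2 x^2$ with $w_1,w_2\in A^*$, $\delta\in\{1,-1\}$. A convergent prefix-rewriting system (CP-RS) for a group $G$ with finite generating set $A$ is a set $R\subseteq A^*\times A^*$ such that $G$ is presented as a monoid by $\langle A\mid u=v\ ((u,v)\in R)\rangle$, and the rewritings $uz\to vz$ for $(u,v)\in R$, $z\in A^*$ satisfy: (termination) there is no infinite sequence of rewritings, and (confluence) the set of words to which no rewriting applies is a set of unique normal forms for $G$. It is bounded if there is $K>0$ such that every $(u,v)\in R$ can be written $(u,v)=(wu',wv')$ with $w,u',v'\in A^*$ and $|u'|+|v'|\le K$. It is regular if $R$ is synchronously regular, i.e. the set of padded words $\hat w$ for $w\in R$ (pad the shorter word with a new symbol $\$$ and read the pair letter by letter over the alphabet $(A\cup\{\$\})^2$) is accepted by a finite state automaton. A group is autostackable if it admits a bounded regular CP-RS over some finite generating set. *)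

theory Defs
  imports "HOL-Algebra.Group"
begin

inductive_set congr :: "'g set \<Rightarrow> ('g list \<times> 'g list) set \<Rightarrow> ('g list \<times> 'g list) set"
  for Sig :: "'g set" and S :: "('g list \<times> 'g list) set" where
  base: "(p, q) \<in> S \<Longrightarrow> l \<in> lists Sig \<Longrightarrow> r \<in> lists Sig \<Longrightarrow> (l @ p @ r, l @ q @ r) \<in> congr Sig S"
| refl: "w \<in> lists Sig \<Longrightarrow> (w, w) \<in> congr Sig S"
| sym: "(u, v) \<in> congr Sig S \<Longrightarrow> (v, u) \<in> congr Sig S"
| trans: "(u, v) \<in> congr Sig S \<Longrightarrow> (v, w) \<in> congr Sig S \<Longrightarrow> (u, w) \<in> congr Sig S"

definition eval_word :: "('a, 'b) monoid_scheme \<Rightarrow> ('g \<Rightarrow> 'a) \<Rightarrow> 'g list \<Rightarrow> 'a" where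
  "eval_word G iota w = foldr (\<lambda>a acc. iota a \<otimes>\<^bsub>G\<^esub> acc) w \<one>\<^bsub>G\<^esub>"

definition presents_monoid :: "('a, 'b) monoid_scheme \<Rightarrow> 'g set \<Rightarrow> ('g \<Rightarrow> 'a) \<Rightarrow> ('g list \<times> 'g list) set \<Rightarrow> bool" where
  "presents_monoid G Sig iota R \<longleftrightarrow>
     R \<subseteq> lists Sig \<times> lists Sig \<and> iota ` Sig \<subseteq> carrier G \<and>
     eval_word G iota ` lists Sig = carrier G \<and>
     (\<forall>u \<in> lists Sig. \<forall>v \<in> lists Sig. eval_word G iota u = eval_word G iota v \<longleftrightarrow> (u, v) \<in> congr Sig R)"

definition prefix_step :: "('g list \<times> 'g list) set \<Rightarrow> 'g list \<Rightarrow> 'g list \<Rightarrow> bool" where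
  "prefix_step R w w' \<longleftrightarrow> (\<exists>u v z. (u, v) \<in> R \<and> w = u @ z \<and> w' = v @ z)"

definition prefix_irreducible :: "('g list \<times> 'g list) set \<Rightarrow> 'g list \<Rightarrow> bool" where
  "prefix_irreducible R w \<longleftrightarrow> \<not> (\<exists>w'. prefix_step R w w')"

definition is_CPRS :: "('a, 'b) monoid_scheme \<Rightarrow> 'g set \<Rightarrow> ('g \<Rightarrow> 'a) \<Rightarrow> ('g list \<times> 'g list) set \<Rightarrow> bool" where
  "is_CPRS G Sig iota R \<longleftrightarrow>
     presents_monoid G Sig iota R \<and>
     wf {(w', w). prefix_step R w w'} \<and>
     (\<forall>g \<in> carrier G. \<exists>!w. w \<in> lists Sig \<and> prefix_irreducible R w \<and> eval_word G iota w = g)"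

definition bounded_RS :: "('g list \<times> 'g list) set \<Rightarrow> bool" where
  "bounded_RS R \<longleftrightarrow> (\<exists>K::nat. K > 0 \<and>
     (\<forall>(u, v) \<in> R. \<exists>w u' v'. u = w @ u' \<and> v = w @ v' \<and> length u' + length v' \<le> K))"

definition pad_pair :: "'g list \<Rightarrow> 'g list \<Rightarrow> ('g option \<times> 'g option) list" where
  "pad_pair u v = zip (map Some u @ replicate (length v - length u) None)
                      (map Some v @ replicate (length u - length v) None)"

definition fsa_accepted :: "'c list set \<Rightarrow> bool" where
  "fsa_accepted L \<longleftrightarrow> (\<exists>(Q :: nat set) (delta :: nat \<Rightarrow> 'c \<Rightarrow> nat) q0 Fin.
      finite Q \<and> q0 \<in> Q \<and> (\<forall>q \<in> Q. \<forall>c. delta q c \<in> Q) \<and> Fin \<subseteq> Q \<and>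
      (\<forall>w. w \<in> L \<longleftrightarrow> foldl delta q0 w \<in> Fin))"

definition sync_regular :: "('g list \<times> 'g list) set \<Rightarrow> bool" where
  "sync_regular R \<longleftrightarrow> fsa_accepted {pad_pair u v | u v. (u, v) \<in> R}"

definition bounded_regular_CPRS :: "('a, 'b) monoid_scheme \<Rightarrow> 'g set \<Rightarrow> ('g \<Rightarrow> 'a) \<Rightarrow> ('g list \<times> 'g list) set \<Rightarrow> bool" where
  "bounded_regular_CPRS G Sig iota R \<longleftrightarrow> is_CPRS G Sig iota R \<and> bounded_RS R \<and> sync_regular R"

text \<open>Autostackable: admits a bounded regular CP-RS over some finite generating set
  (a finite alphabet, coded by natural numbers, mapped into G).\<close>
definition autostackable :: "('a, 'b) monoid_scheme \<Rightarrow> bool" where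
  "autostackable G \<longleftrightarrow> group G \<and>
     (\<exists>(Sig :: nat set) (iota :: nat \<Rightarrow> 'a) R. finite Sig \<and> bounded_regular_CPRS G Sig iota R)"

datatype gen = X | Xi | Y | Yi

fun ginv :: "gen \<Rightarrow> gen" where
  "ginv X = Xi" | "ginv Xi = X" | "ginv Y = Yi" | "ginv Yi = Y"

text \<open>Relators [y, x y x^-2] and [y, x^2 y x^-3], with [a,b] = a^-1 b^-1 a b.\<close>
definition F_rel1 :: "gen list" where
  "F_rel1 = [Yi] @ [X, X, Yi, Xi] @ [Y] @ [X, Y, Xi, Xi]"
definition F_rel2 :: "gen list" where
  "F_rel2 = [Yi] @ [X, X, X, Yi, Xi, Xi] @ [Y] @ [X, X, Y, Xi, Xi, Xi]"

definition F_rels :: "(gen list \<times> gen list) set" where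
  "F_rels = {([a, ginv a], []) | a. True} \<union> {(F_rel1, []), (F_rel2, [])}"

definition F_class :: "gen list \<Rightarrow> gen list set" where
  "F_class w = {v. (w, v) \<in> congr UNIV F_rels}"

definition ThompsonF :: "gen list set monoid" where
  "ThompsonF = \<lparr> carrier = range F_class,
                 mult = (\<lambda>P Q. F_class ((SOME u. u \<in> P) @ (SOME v. v \<in> Q))),
                 one = F_class [] \<rparr>"

definition F_gen :: "gen \<Rightarrow> gen list set" where
  "F_gen a = F_class [a]"

definition subword :: "'g list \<Rightarrow> 'g list \<Rightarrow> bool" where
  "subword s w \<longleftrightarrow> (\<exists>p q. w = p @ s @ q)"

definition yeps :: "gen set" where "yeps = {Y, Yi}"

definition xpow :: "nat \<Rightarrow> gen list" where "xpow i = replicate i X"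
definition xinvpow :: "nat \<Rightarrow> gen list" where "xinvpow i = replicate i Xi"

definition NN :: "gen list set" where
  "NN = {w. (\<forall>a. \<not> subword [a, ginv a] w) \<and>
            (\<forall>e \<in> yeps. \<forall>i::nat. i \<ge> 1 \<longrightarrow> \<not> subword ([e] @ xpow i @ [Y]) w) \<and>
            (\<forall>e \<in> yeps. \<forall>i::nat. i \<ge> 1 \<longrightarrow> \<not> subword ([e] @ xpow (i + 1) @ [Yi]) w)}"

definition AyAx2 :: "gen list set" where
  "AyAx2 = {w1 @ [d] @ w2 @ [X, X] | w1 d w2. d \<in> yeps}"

definition R_F :: "(gen list \<times> gen list) set" where
  "R_F =
     {(u @ [a, ginv a], u) | u a. True}
   \<union> {(u @ [e] @ xpow i @ [Y], u @ xpow i @ [Y] @ xinvpow (i + 1) @ [e] @ xpow (i + 1))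
       | u e i. e \<in> yeps \<and> i \<in> {1, 2} \<and> u @ [e] @ xpow i \<in> NN}
   \<union> {(u @ [e] @ xpow i @ [Yi], u @ xpow i @ [Yi] @ xinvpow (i - 1) @ [e] @ xpow (i - 1))
       | u e i. e \<in> yeps \<and> i \<in> {2, 3} \<and> u @ [e] @ xpow i \<in> NN}
   \<union> {(u @ [X, Y], u @ [Yi, X, Y, Xi, Xi, Y, X, X]) | u. u \<in> NN \<inter> AyAx2}
   \<union> {(u @ [X, X, Yi], u @ [Yi, X, X, Yi, Xi, Y, X]) | u. u \<in> NN \<inter> AyAx2}"

end

theory Submission
  imports Defs
begin

text \<open>With \<open>z\<^sub>h = x\<^sup>h y x\<^sup>-\<^sup>h\<close>, a word is a product of letters \<open>z\<^sub>h\<^sup>\<plusminus>\<^sup>1\<close> times a power of \<open>x\<close>, and the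
  relators say \<open>z\<^sub>h z\<^sub>g = z\<^sub>g z\<^sub>h\<^sub>-\<^sub>1\<close> for \<open>g - h \<in> {1, 2}\<close>. Sliding each new letter to the left as far as
  possible defines an action of Thompson's group on normal sequences of letters, and a word in
  \<open>\<N>\<close> can be read off from the image of the base point; hence distinct words in \<open>\<N>\<close> represent
  distinct elements. Irreducible words lie in \<open>\<N>\<close>, so it remains to see that rewriting terminates:
  a word is a path in the Cayley graph, and every rule other than free cancellation replaces an edge
  outside the spanning tree given by \<open>\<N>\<close> by at most three such edges, for each of which a weighted
  count of the letters to be passed is smaller. Regularity holds because the languages involved
  have finitely many left quotients.\<close>

section \<open>Regular languages via left quotients\<close>

definition quot :: "'c list set \<Rightarrow> 'c list \<Rightarrow> 'c list set" where
  "quot L w = {v. w @ v \<in> L}"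

definition conc :: "'c list set \<Rightarrow> 'c list set \<Rightarrow> 'c list set" where
  "conc A B = {u @ v | u v. u \<in> A \<and> v \<in> B}"

text \<open>Myhill-Nerode: the state reached by \<open>w\<close> determines \<open>quot L w\<close>;
  conversely the quotients themselves serve as states. Closure properties then reduce to counting
  quotients.\<close>

lemma fsa_accepted_iff_finite_quots:
  "fsa_accepted L \<longleftrightarrow> finite (range (quot L))"
proof
  assume "fsa_accepted L"
  then obtain Q :: "nat set" and delta q0 Fin where fin: "finite Q" and q0: "q0 \<in> Q"
    and delta: "\<forall>q\<in>Q. \<forall>c. delta q c \<in> Q" and acc: "\<forall>w. w \<in> L \<longleftrightarrow> foldl delta q0 w \<in> Fin"
    unfolding fsa_accepted_def by (elim exE conjE) (rule that)
  have reach: "foldl delta q0 w \<in> Q" for w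
    by (induction w rule: rev_induct) (auto simp: q0 delta)
  have "range (quot L) \<subseteq> (\<lambda>q. {v. foldl delta q v \<in> Fin}) ` Q"
    using reach by (auto simp: quot_def acc)
  then show "finite (range (quot L))"
    using fin finite_surj by blast
next
  assume fin: "finite (range (quot L))"
  \<comment> \<open>States in \<open>fsa_accepted\<close> are naturals, so the finitely many
    quotients are numbered by an injection.\<close>
  then obtain f :: "'a list set \<Rightarrow> nat" where inj: "inj_on f (range (quot L))"
    by (elim finite_imp_inj_to_nat_seg[elim_format] exE conjE) (rule that)
  define delta where "delta q c = f (quot (inv_into (range (quot L)) f q) [c])" for q c
  have quot_quot: "quot (quot L u) [c] = quot L (u @ [c])" for u c
    by (simp add: quot_def)
  define Fin where "Fin = f ` {P \<in> range (quot L). [] \<in> P}"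
  have step: "delta (f (quot L u)) c = f (quot L (u @ [c]))" for u c
    by (simp add: delta_def inv_into_f_f[OF inj] quot_quot)
  have run: "foldl delta (f (quot L [])) w = f (quot L w)" for w
    by (induction w rule: rev_induct) (auto simp: step)
  have acc: "w \<in> L \<longleftrightarrow> foldl delta (f (quot L [])) w \<in> Fin" for w
  proof -
    have "f (quot L w) \<in> Fin \<longleftrightarrow> [] \<in> quot L w"
      unfolding Fin_def using inj by (auto dest: inj_onD)
    then show ?thesis unfolding run by (simp add: quot_def)
  qed
  show "fsa_accepted L"
    unfolding fsa_accepted_def
  proof (intro exI conjI)
    show "finite (f ` range (quot L))" using fin by blast
    show "f (quot L []) \<in> f ` range (quot L)" by blast
    show "\<forall>q \<in> f ` range (quot L). \<forall>c. delta q c \<in> f ` range (quot L)" using step by auto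
    show "Fin \<subseteq> f ` range (quot L)" unfolding Fin_def by blast
    show "\<forall>w. (w \<in> L) = (foldl delta (f (quot L [])) w \<in> Fin)" using acc by blast
  qed
qed

lemma fsa_accepted_Compl: "fsa_accepted L \<Longrightarrow> fsa_accepted (- L)"
proof -
  have "quot (- L) w = - quot L w" for w by (auto simp: quot_def)
  then have "range (quot (- L)) = uminus ` range (quot L)" by auto
  then show "fsa_accepted L \<Longrightarrow> fsa_accepted (- L)" by (simp add: fsa_accepted_iff_finite_quots)
qed

lemma fsa_accepted_Un:
  assumes "fsa_accepted A" "fsa_accepted B"
  shows "fsa_accepted (A \<union> B)"
proof -
  have "quot (A \<union> B) w = quot A w \<union> quot B w" for w by (auto simp: quot_def)
  then have "range (quot (A \<union> B)) \<subseteq> (\<lambda>(P, Q). P \<union> Q) ` (range (quot A) \<times> range (quot B))"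
    by auto
  from finite_surj[OF _ this] show ?thesis
    using assms by (simp add: fsa_accepted_iff_finite_quots)
qed

lemma fsa_accepted_Int:
  assumes "fsa_accepted A" "fsa_accepted B"
  shows "fsa_accepted (A \<inter> B)"
  using fsa_accepted_Compl[OF fsa_accepted_Un[OF assms[THEN fsa_accepted_Compl]]] by simp

lemma fsa_accepted_lists: "fsa_accepted (lists S)"
proof -
  have "range (quot (lists S)) \<subseteq> {lists S, {}}" by (auto simp: quot_def)
  then show ?thesis by (simp add: fsa_accepted_iff_finite_quots finite_subset)
qed

lemma fsa_accepted_UNIV: "fsa_accepted UNIV"
  using fsa_accepted_lists[of UNIV] by simp

lemma fsa_accepted_empty: "fsa_accepted {}"
  using fsa_accepted_Compl[OF fsa_accepted_UNIV] by simp

lemma fsa_accepted_UN: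
  assumes "finite I" "\<And>i. i \<in> I \<Longrightarrow> fsa_accepted (L i)"
  shows "fsa_accepted (\<Union>i\<in>I. L i)"
  using assms by (induction I) (auto intro: fsa_accepted_Un simp: fsa_accepted_empty)

lemma fsa_accepted_singleton: "fsa_accepted {c}"
proof -
  have "v \<in> (\<lambda>i. drop i c) ` {..length c}" if "w @ v = c" for w v
    using that by (intro image_eqI[of _ _ "length w"]) auto
  then have "range (quot {c}) \<subseteq> Pow ((\<lambda>i. drop i c) ` {..length c})"
    unfolding quot_def by blast
  then show ?thesis unfolding fsa_accepted_iff_finite_quots
    by (rule finite_subset) simp
qed

text \<open>Either \<open>w\<close> ends inside the factor from \<open>A\<close>, or it splits into
  a word of \<open>A\<close> and a beginning of a word of \<open>B\<close>. So its quotient depends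
  only on \<open>quot A w\<close> and on a subset of the quotients of \<open>B\<close>: the subset
  construction.\<close>

lemma fsa_accepted_conc:
  assumes "fsa_accepted A" "fsa_accepted B"
  shows "fsa_accepted (conc A B)"
proof -
  have "quot (conc A B) w = conc (quot A w) B \<union> \<Union>{quot B v | u v. w = u @ v \<and> u \<in> A}" for w
    by (auto simp: quot_def conc_def append_eq_append_conv2) blast+
  then have "range (quot (conc A B))
      \<subseteq> (\<lambda>(P, Q). conc P B \<union> \<Union>Q) ` (range (quot A) \<times> Pow (range (quot B)))"
    by (force simp del: Sup_insert)
  from finite_surj[OF _ this] show ?thesis
    using assms by (simp add: fsa_accepted_iff_finite_quots)
qed

text \<open>Injectivity makes the preimage of \<open>w\<close> unique; a \<open>w\<close> without
  preimage has empty quotient, hence the extra \<open>{}\<close>.\<close>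

lemma fsa_accepted_map:
  assumes "fsa_accepted L" "inj f"
  shows "fsa_accepted (map f ` L)"
proof -
  have "quot (map f ` L) w \<in> insert {} (((`) (map f)) ` range (quot L))" for w
  proof (cases "w \<in> range (map f)")
    case True
    then obtain u where w: "w = map f u" by blast
    have "quot (map f ` L) w = map f ` quot L u"
      using \<open>inj f\<close> by (auto simp: quot_def w image_iff map_eq_append_conv append_eq_map_conv
          inj_map_eq_map)
    then show ?thesis by blast
  next
    case False
    then have "quot (map f ` L) w = {}" by (auto simp: quot_def append_eq_map_conv)
    then show ?thesis by blast
  qed
  then have "range (quot (map f ` L)) \<subseteq> insert {} (((`) (map f)) ` range (quot L))" by blast
  from finite_subset[OF this] show ?thesis
    using assms(1) by (simp add: fsa_accepted_iff_finite_quots)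
qed

text \<open>Serves the side conditions \<open>u @ [e] @ xpow i \<in> NN\<close>, which restrict
  \<open>u\<close> to a right quotient of \<open>NN\<close>.\<close>

lemma fsa_accepted_right_quot:
  assumes "fsa_accepted L"
  shows "fsa_accepted {u. u @ c \<in> L}"
proof -
  have "quot {u. u @ c \<in> L} w = {v. v @ c \<in> quot L w}" for w by (simp add: quot_def)
  then have "range (quot {u. u @ c \<in> L}) = (\<lambda>P. {v. v @ c \<in> P}) ` range (quot L)" by auto
  then show ?thesis using assms by (simp add: fsa_accepted_iff_finite_quots)
qed

section \<open>The rules of the system\<close>

text \<open>For fixed parameters each rule family replaces one fixed suffix behind a regular set of
  prefixes; regularity and boundedness are proved for this shape.\<close>

definition rule_set :: "'g list set \<Rightarrow> 'g list \<Rightarrow> 'g list \<Rightarrow> ('g list \<times> 'g list) set" where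
  "rule_set L l r = {(u @ l, u @ r) | u. u \<in> L}"

lemma R_F_eq:
  "R_F = (\<Union>a. rule_set UNIV [a, ginv a] [])
   \<union> (\<Union>e\<in>yeps. \<Union>i\<in>{1, 2}. rule_set {u. u @ [e] @ xpow i \<in> NN}
        ([e] @ xpow i @ [Y]) (xpow i @ [Y] @ xinvpow (i + 1) @ [e] @ xpow (i + 1)))
   \<union> (\<Union>e\<in>yeps. \<Union>i\<in>{2, 3}. rule_set {u. u @ [e] @ xpow i \<in> NN}
        ([e] @ xpow i @ [Yi]) (xpow i @ [Yi] @ xinvpow (i - 1) @ [e] @ xpow (i - 1)))
   \<union> rule_set (NN \<inter> AyAx2) [X, Y] [Yi, X, Y, Xi, Xi, Y, X, X]
   \<union> rule_set (NN \<inter> AyAx2) [X, X, Yi] [Yi, X, X, Yi, Xi, Y, X]"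
  unfolding R_F_def rule_set_def by (intro arg_cong2[where f="(\<union>)"]) blast+

section \<open>Regularity of the side conditions\<close>

lemma finite_gen: "finite (UNIV :: gen set)"
proof -
  have "a \<in> {X, Xi, Y, Yi}" for a by (cases a) auto
  then have "UNIV = {X, Xi, Y, Yi}" by blast
  then show ?thesis by (metis finite.emptyI finite.insertI)
qed

lemma finite_yeps: "finite yeps"
  by (simp add: yeps_def)

lemma subword_set: "{w. subword s w} = conc UNIV (conc {s} UNIV)"
  by (auto simp: subword_def conc_def)

lemma lists_singleton: "lists {a} = range (\<lambda>i. replicate i a)"
proof -
  have "w = replicate (length w) a" if "w \<in> lists {a}" for w
    using that by (intro replicate_eqI) auto
  then show ?thesis by auto
qed

text \<open>The pattern is the regular expression \<open>e X^(k+1) X^* b\<close>;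
  \<open>k = 0\<close> and \<open>k = 1\<close> yield the two kinds of forbidden subwords in
  \<open>NN\<close>.\<close>

lemma fsa_accepted_subword_xpow:
  "fsa_accepted {w. \<exists>i\<ge>1. subword ([e] @ xpow (i + k) @ [b]) w}"
proof -
  have "(\<exists>i\<ge>1. w = [e] @ xpow (i + k) @ [b]) \<longleftrightarrow>
      w \<in> conc {e # replicate (Suc k) X} (conc (lists {X}) {[b]})" for w
  proof
    assume "\<exists>i\<ge>1. w = [e] @ xpow (i + k) @ [b]"
    then obtain i where "i \<ge> 1" "w = [e] @ xpow (i + k) @ [b]" by blast
    then have "w = (e # replicate (Suc k) X) @ replicate (i - 1) X @ [b]"
      by (simp add: xpow_def replicate_add[symmetric] add.commute flip: append_assoc replicate_Suc)
    then show "w \<in> conc {e # replicate (Suc k) X} (conc (lists {X}) {[b]})"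
      unfolding conc_def lists_singleton by blast
  next
    assume "w \<in> conc {e # replicate (Suc k) X} (conc (lists {X}) {[b]})"
    then obtain j where "w = (e # replicate (Suc k) X) @ replicate j X @ [b]"
      unfolding conc_def lists_singleton by blast
    then have "w = [e] @ xpow (Suc j + k) @ [b]"
      by (simp add: xpow_def replicate_add[symmetric] add.commute flip: append_assoc)
    then show "\<exists>i\<ge>1. w = [e] @ xpow (i + k) @ [b]" by (intro exI[of _ "Suc j"]) simp
  qed
  then have "conc {e # replicate (Suc k) X} (conc (lists {X}) {[b]}) =
      {w. \<exists>i\<ge>1. w = [e] @ xpow (i + k) @ [b]}"
    by blast
  moreover have "{w. \<exists>i\<ge>1. subword ([e] @ xpow (i + k) @ [b]) w} =
      conc UNIV (conc {w. \<exists>i\<ge>1. w = [e] @ xpow (i + k) @ [b]} UNIV)"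
    unfolding conc_def subword_def by blast
  ultimately have "{w. \<exists>i\<ge>1. subword ([e] @ xpow (i + k) @ [b]) w} =
      conc UNIV (conc (conc {e # replicate (Suc k) X} (conc (lists {X}) {[b]})) UNIV)"
    by simp
  then show ?thesis
    by (simp add: fsa_accepted_conc fsa_accepted_UNIV fsa_accepted_singleton fsa_accepted_lists)
qed

lemma fsa_accepted_NN: "fsa_accepted NN"
proof -
  have "NN = - ((\<Union>a. {w. subword [a, ginv a] w})
      \<union> (\<Union>e\<in>yeps. {w. \<exists>i\<ge>1. subword ([e] @ xpow (i + 0) @ [Y]) w})
      \<union> (\<Union>e\<in>yeps. {w. \<exists>i\<ge>1. subword ([e] @ xpow (i + 1) @ [Yi]) w}))"
    unfolding NN_def by auto
  then show ?thesis
    by (elim ssubst) (intro fsa_accepted_Compl fsa_accepted_Un fsa_accepted_UN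
        fsa_accepted_subword_xpow finite_gen finite_yeps,
      auto simp: subword_set intro!: fsa_accepted_conc fsa_accepted_UNIV fsa_accepted_singleton)
qed

lemma fsa_accepted_AyAx2: "fsa_accepted AyAx2"
proof -
  have "conc UNIV (conc {[d]} (conc UNIV {[X, X]})) = {w1 @ [d] @ w2 @ [X, X] | w1 w2. True}" for d
    by (simp add: conc_def) metis
  then have "AyAx2 = (\<Union>d\<in>yeps. conc UNIV (conc {[d]} (conc UNIV {[X, X]})))"
    unfolding AyAx2_def by (simp only:) blast
  then show ?thesis
    by (elim ssubst) (auto intro!: fsa_accepted_UN fsa_accepted_conc fsa_accepted_UNIV fsa_accepted_singleton
        finite_yeps)
qed

section \<open>Padded languages of the rules\<close>

definition pad_lang :: "('g list \<times> 'g list) set \<Rightarrow> ('g option \<times> 'g option) list set" where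
  "pad_lang R = (\<lambda>(u, v). pad_pair u v) ` R"

lemma sync_regular_pad_lang: "sync_regular R \<longleftrightarrow> fsa_accepted (pad_lang R)"
proof -
  have "{pad_pair u v | u v. (u, v) \<in> R} = pad_lang R" by (auto simp: pad_lang_def)
  then show ?thesis by (simp add: sync_regular_def)
qed

text \<open>A common prefix is read on the diagonal and does not affect the padding, so a
  \<open>rule_set\<close> pads to a diagonal copy of \<open>L\<close> followed by one fixed
  word.\<close>

lemma pad_pair_append:
  "pad_pair (u @ l) (u @ r) = map (\<lambda>a. (Some a, Some a)) u @ pad_pair l r"
  by (induction u) (auto simp: pad_pair_def)

lemma sync_regular_rule_set:
  assumes "fsa_accepted L"
  shows "sync_regular (rule_set L l r)"
proof -
  have "pad_lang (rule_set L l r) = conc (map (\<lambda>a. (Some a, Some a)) ` L) {pad_pair l r}"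
    unfolding pad_lang_def rule_set_def conc_def by (force simp: pad_pair_append)
  moreover have "inj (\<lambda>a::'a. (Some a, Some a))" by (simp add: inj_def)
  ultimately show ?thesis
    using assms by (simp add: sync_regular_pad_lang fsa_accepted_conc fsa_accepted_singleton
        fsa_accepted_map)
qed

lemma sync_regular_Un: "sync_regular R \<Longrightarrow> sync_regular S \<Longrightarrow> sync_regular (R \<union> S)"
  by (simp add: sync_regular_pad_lang pad_lang_def image_Un fsa_accepted_Un)

lemma sync_regular_UN:
  "finite I \<Longrightarrow> (\<And>i. i \<in> I \<Longrightarrow> sync_regular (R i)) \<Longrightarrow> sync_regular (\<Union>i\<in>I. R i)"
  by (simp add: sync_regular_pad_lang pad_lang_def image_UN fsa_accepted_UN)

lemma sync_regular_R_F: "sync_regular R_F"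
  unfolding R_F_eq
  by (intro sync_regular_Un sync_regular_UN sync_regular_rule_set finite_gen finite_yeps
      fsa_accepted_UNIV fsa_accepted_right_quot fsa_accepted_NN fsa_accepted_Int fsa_accepted_AyAx2)
    auto

lemma bounded_RS_rule_set: "(u, v) \<in> rule_set L l r \<Longrightarrow> length l + length r \<le> K \<Longrightarrow>
  \<exists>w u' v'. u = w @ u' \<and> v = w @ v' \<and> length u' + length v' \<le> K"
  unfolding rule_set_def by blast

lemma bounded_RS_R_F: "bounded_RS R_F"
proof -
  \<comment> \<open>The longest replaced and replacing suffixes have total length 14, so 20 is
    ample.\<close>
  have "\<exists>w u' v'. u = w @ u' \<and> v = w @ v' \<and> length u' + length v' \<le> 20"
    if "(u, v) \<in> R_F" for u v
    using that unfolding R_F_eq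
    by (elim UnE UN_E) (erule bounded_RS_rule_set, force simp: xpow_def xinvpow_def)+
  then show ?thesis unfolding bounded_RS_def by (intro exI[of _ 20]) auto
qed

section \<open>The action on normal stacks\<close>

text \<open>A stack lists the letters \<open>z\<^sub>h\<^sup>\<plusminus>\<^sup>1\<close> as pairs of a sign and \<open>h\<close>, the last letter on top; a state is
  a stack with the exponent of the final power of \<open>x\<close>. A pushed letter \<open>z\<^sub>m\<^sup>\<plusminus>\<^sup>1\<close> slides past all letters of
  height below a threshold, shifting each of them by one, and is then inserted or cancelled.\<close>

fun threshold :: "bool \<Rightarrow> int \<Rightarrow> int" where
  "threshold True m = m"
| "threshold False m = m - 1"

fun sign :: "bool \<Rightarrow> int" where
  "sign True = 1"
| "sign False = - 1"

fun push :: "bool \<Rightarrow> int \<Rightarrow> (bool \<times> int) list \<Rightarrow> (bool \<times> int) list" where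
  "push p m [] = [(p, m)]"
| "push p m ((q, h) # s) =
    (if h < threshold p m then (q, h - sign p) # push p m s
     else if q \<noteq> p \<and> h = m then s else (p, m) # (q, h) # s)"

text \<open>The condition under which \<open>push p m s\<close> neither slides nor cancels, so that
  the letter goes on top.\<close>

fun stackable :: "bool \<Rightarrow> int \<Rightarrow> (bool \<times> int) list \<Rightarrow> bool" where
  "stackable p m [] = True"
| "stackable p m ((q, h) # s) = (threshold p m \<le> h \<and> \<not> (q \<noteq> p \<and> h = m))"

fun normal_stack :: "(bool \<times> int) list \<Rightarrow> bool" where
  "normal_stack [] = True"
| "normal_stack ((p, m) # s) = (stackable p m s \<and> normal_stack s)"

lemma push_stackable: "stackable p m s \<Longrightarrow> push p m s = (p, m) # s"
  by (cases s) auto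

text \<open>The letter just passed can be put back on top. If the new letter slides further, both
  heights shift alike; if it is inserted, it is high enough itself; if it cancels, the letter below
  is high enough by normality, hence the split of \<open>tl s\<close>.\<close>

lemma stackable_push:
  assumes "normal_stack s" "stackable q h s" "h < threshold p m"
  shows "stackable q (h - sign p) (push p m s)"
  using assms
  by (cases p; cases q; cases s rule: normal_stack.cases; cases "tl s" rule: normal_stack.cases) auto

lemma normal_stack_push: "normal_stack s \<Longrightarrow> normal_stack (push p m s)"
proof (induction s rule: normal_stack.induct)
  case (2 q h s)
  then show ?case
    using stackable_push[of s q h p m] by (cases p; cases q) auto
qed auto

text \<open>As \<open>h < threshold p m\<close> is equivalent to
  \<open>h - sign p < threshold (\<not> p) m\<close>, the inverse letter passes exactly the letters
  that the first one passed and undoes their shifts.\<close>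

lemma push_inverse: "normal_stack s \<Longrightarrow> push (\<not> p) m (push p m s) = s"
proof (induction s rule: normal_stack.induct)
  case 1
  then show ?case by (cases p) auto
next
  case (2 q h s)
  then show ?case
    by (cases p; cases q; cases s rule: normal_stack.cases) auto
qed

text \<open>The relation \<open>z_h z_g = z_g z_(h-1)\<close>; the two relators are its instances
  \<open>g - h = 1\<close> and \<open>g - h = 2\<close>. A top letter below \<open>h\<close> is
  shifted twice on both sides; otherwise few cases remain.\<close>

lemma push_push:
  assumes "normal_stack s" "h < g"
  shows "push True g (push True h s) = push True (h - 1) (push True g s)"
  using assms
proof (induction s rule: normal_stack.induct)
  case (2 q k s)
  show ?case
  proof (cases "k < h")
    case True
    then show ?thesis using 2 by auto
  next
    case False
    then show ?thesis using 2
      by (cases s rule: normal_stack.cases; cases q) auto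
  qed
qed auto

type_synonym state = "(bool \<times> int) list \<times> int"

fun act :: "state \<Rightarrow> gen \<Rightarrow> state" where
  "act (s, n) X = (s, n + 1)"
| "act (s, n) Xi = (s, n - 1)"
| "act (s, n) Y = (push True n s, n)"
| "act (s, n) Yi = (push False n s, n)"

abbreviation run :: "state \<Rightarrow> gen list \<Rightarrow> state" where
  "run \<equiv> foldl act"

lemma normal_stack_run: "normal_stack (fst st) \<Longrightarrow> normal_stack (fst (run st w))"
proof (induction w rule: rev_induct)
  case (snoc a w)
  then show ?case
    by (cases "run st w"; cases a) (auto simp: normal_stack_push)
qed simp

text \<open>This makes \<open>act\<close> an action of the group on normal states.\<close>

lemma run_relation:
  assumes "(p, q) \<in> F_rels" "normal_stack (fst st)"
  shows "run st p = run st q"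
proof -
  obtain s n where st: "st = (s, n)" and s: "normal_stack s"
    using assms(2) by (cases st) auto
  have pp: "push True (m + k) (push True (m + 1) t) = push True m (push True (m + k) t)"
    if "normal_stack t" "k > 1" for t m k
    using push_push[OF that(1), of "m + 1" "m + k"] that(2) by simp
  have fi: "push True m (push False m t) = t" if "normal_stack t" for m t
    using push_inverse[OF that, of False] by simp
  have tf: "push False m (push True m t) = t" if "normal_stack t" for m t
    using push_inverse[OF that, of True] by simp
  consider a where "p = [a, ginv a]" "q = []" | "p = F_rel1" "q = []" | "p = F_rel2" "q = []"
    using assms(1) unfolding F_rels_def by auto
  then show ?thesis
  proof cases
    case 1
    then show ?thesis using s by (cases a) (simp_all add: st fi tf)
  next
    case 2
    \<comment> \<open>From exponent \<open>n\<close> the relator pushes heights \<open>n\<close>,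
      \<open>n + 2\<close>, \<open>n + 1\<close>, \<open>n + 2\<close>, the first two with negative
      sign. By \<open>pp\<close> the last two may be replaced by \<open>n + 2\<close>,
      \<open>n\<close>, and the inverse pairs cancel from the inside out.\<close>
    then show ?thesis using s pp[of "push False (n + 2) (push False n s)" 2 n]
      by (simp add: st F_rel1_def fi normal_stack_push add.commute)
  next
    case 3
    then show ?thesis using s pp[of "push False (n + 3) (push False n s)" 3 n]
      by (simp add: st F_rel2_def fi normal_stack_push add.commute)
  qed
qed

lemma run_congr:
  assumes "(u, v) \<in> congr UNIV F_rels" "normal_stack (fst st)"
  shows "run st u = run st v"
  using assms
proof (induction arbitrary: st rule: congr.induct)
  case (base p q l r)
  then show ?case using run_relation[of p q "run st l"] by (simp add: normal_stack_run)
qed auto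

section \<open>Normal forms are recovered from their states\<close>

definition yletter :: "bool \<Rightarrow> gen" where
  "yletter p = (if p then Y else Yi)"

definition xpower :: "int \<Rightarrow> gen list" where
  "xpower k = (if k \<ge> 0 then replicate (nat k) X else replicate (nat (- k)) Xi)"

text \<open>The product of the letters \<open>x^h y^(+-1) x^(-h)\<close>, bottom of the stack first,
  and of \<open>x^n\<close>, with adjacent powers of \<open>x\<close> merged.\<close>

fun word_of :: "(bool \<times> int) list \<Rightarrow> int \<Rightarrow> gen list" where
  "word_of [] n = xpower n"
| "word_of ((p, h) # s) n = word_of s h @ [yletter p] @ xpower (n - h)"

lemma xpower_snoc_X: "k \<ge> 0 \<Longrightarrow> xpower (k + 1) = xpower k @ [X]"
  by (simp add: xpower_def nat_add_distrib flip: replicate_append_same)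

lemma xpower_snoc_Xi: "k \<le> 0 \<Longrightarrow> xpower (k - 1) = xpower k @ [Xi]"
proof -
  assume "k \<le> 0"
  then have "nat (1 - k) = Suc (nat (- k))" by simp
  then show ?thesis using \<open>k \<le> 0\<close>
    by (cases "k = 0") (auto simp: xpower_def replicate_append_same)
qed

lemma xpower_nat: "xpower (int i) = xpow i"
  by (simp add: xpower_def xpow_def)

text \<open>A change of \<open>n\<close> touches only the final power of \<open>x\<close>; this
  describes the effect of reading \<open>X\<close> or \<open>Xi\<close>.\<close>

lemma word_of_suffix: "\<exists>l k. \<forall>d. word_of s (n + d) = l @ xpower (k + d)"
proof (cases s rule: normal_stack.cases)
  case 1
  then show ?thesis by (intro exI[of _ "[]"] exI[of _ n]) simp
next
  case (2 p h t)
  then show ?thesis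
    by (intro exI[of _ "word_of t h @ [yletter p]"] exI[of _ "n - h"]) (simp add: algebra_simps)
qed

lemma NN_prefix: "u @ v \<in> NN \<Longrightarrow> u \<in> NN"
proof -
  have "subword s (u @ v)" if "subword s u" for s
    using that unfolding subword_def by (metis append.assoc)
  then show "u @ v \<in> NN \<Longrightarrow> u \<in> NN"
    unfolding NN_def by blast
qed

lemma NN_factorD:
  assumes "l @ s @ r \<in> NN"
  shows "s \<noteq> [a, ginv a]"
    and "e \<in> yeps \<Longrightarrow> i \<ge> 1 \<Longrightarrow> s \<noteq> [e] @ xpow i @ [Y]"
    and "e \<in> yeps \<Longrightarrow> i \<ge> 1 \<Longrightarrow> s \<noteq> [e] @ xpow (i + 1) @ [Yi]"
  using assms unfolding NN_def subword_def by blast+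

lemma yletter_yeps [simp]: "yletter p \<in> yeps"
  by (simp add: yletter_def yeps_def)

text \<open>With \<open>(q, h)\<close> on top the word ends in a y-letter, \<open>x^(n-h)\<close>
  and \<open>yletter p\<close>. Sliding means \<open>n - h \<ge> 1\<close> for positive
  \<open>p\<close> and \<open>n - h \<ge> 2\<close> for negative \<open>p\<close>; cancelling means
  \<open>n = h\<close> with opposite signs. These are forbidden subwords of
  \<open>NN\<close>.\<close>

lemma NN_snoc_stackable:
  assumes "word_of s n @ [yletter p] \<in> NN"
  shows "stackable p n s"
proof (cases s rule: normal_stack.cases)
  case (2 q h t)
  have no: "word_of t h @ ([yletter q] @ xpower (n - h) @ [yletter p]) @ [] \<in> NN"
    using assms 2 by simp
  show ?thesis
  proof (rule ccontr)
    assume "\<not> stackable p n s"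
    then consider "h < threshold p n" | "h = n" "q \<noteq> p" using 2 by auto
    then show False
    proof cases
      case 1
      then obtain i where i: "n - h = int i" and "i \<ge> 1" "\<not> p \<longrightarrow> i \<ge> 2"
        by (cases p) (auto intro!: that[of "nat (n - h)"])
      moreover have "1 \<le> i - 1" if "2 \<le> i" using that by simp
      ultimately show False
        using NN_factorD(2)[OF no yletter_yeps[of q], of i] NN_factorD(3)[OF no yletter_yeps[of q], of "i - 1"]
        by (cases p) (auto simp: xpower_nat yletter_def)
    next
      case 2
      then show False
        using NN_factorD(1)[OF no, of "yletter q"] by (cases p) (auto simp: xpower_def yletter_def)
    qed
  qed
qed simp

text \<open>Along a word in \<open>NN\<close> nothing slides or cancels: every y-letter goes on top,
  and every x-letter extends the final power, since shortening it would need a subword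
  \<open>[a, ginv a]\<close>.\<close>

lemma word_of_run:
  assumes "w \<in> NN" "run ([], 0) w = (s, n)"
  shows "word_of s n = w"
  using assms
proof (induction w arbitrary: s n rule: rev_induct)
  case Nil
  then show ?case by (simp add: xpower_def)
next
  case (snoc a w)
  obtain t m where tm: "run ([], 0) w = (t, m)" by fastforce
  have w: "word_of t m = w"
    using snoc.IH[OF _ tm] snoc.prems(1) NN_prefix by blast
  obtain l k where lk: "\<forall>d. word_of t (m + d) = l @ xpower (k + d)"
    using word_of_suffix by blast
  have lk0: "w = l @ xpower k" using lk w by (metis add.right_neutral)
  have stack: "stackable p m t" if "a = yletter p" for p
    using NN_snoc_stackable[of t m p] snoc.prems(1) w that by simp
  show ?case
  proof (cases a)
    case X
    have "k \<ge> 0"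
    proof (rule ccontr)
      assume "\<not> k \<ge> 0"
      then have "w @ [a] = (l @ xpower (k + 1)) @ [Xi, X] @ []"
        using lk0 xpower_snoc_Xi[of "k + 1"] X by simp
      then show False using NN_factorD(1)[of "l @ xpower (k + 1)" "[Xi, X]" "[]" Xi] snoc.prems(1) by simp
    qed
    then show ?thesis using snoc.prems(2) tm X lk lk0 by (auto simp: xpower_snoc_X)
  next
    case Xi
    have "k \<le> 0"
    proof (rule ccontr)
      assume "\<not> k \<le> 0"
      then have "w @ [a] = (l @ xpower (k - 1)) @ [X, Xi] @ []"
        using lk0 xpower_snoc_X[of "k - 1"] Xi by simp
      then show False using NN_factorD(1)[of "l @ xpower (k - 1)" "[X, Xi]" "[]" X] snoc.prems(1) by simp
    qed
    then show ?thesis using snoc.prems(2) tm Xi lk[rule_format, of "-1"] lk0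
      by (auto simp: xpower_snoc_Xi)
  next
    case Y
    then show ?thesis using snoc.prems(2) tm w stack[of True] push_stackable[of True m t]
      by (auto simp: yletter_def xpower_def)
  next
    case Yi
    then show ?thesis using snoc.prems(2) tm w stack[of False] push_stackable[of False m t]
      by (auto simp: yletter_def xpower_def)
  qed
qed

lemma NN_unique:
  assumes "u \<in> NN" "v \<in> NN" "(u, v) \<in> congr UNIV F_rels"
  shows "u = v"
proof -
  obtain s n where "run ([], 0) u = (s, n)" by fastforce
  moreover from this have "run ([], 0) v = (s, n)"
    using run_congr[OF assms(3), of "([], 0)"] by simp
  ultimately show ?thesis
    using word_of_run[OF assms(1)] word_of_run[OF assms(2)] by metis
qed

section \<open>The cost of a path\<close>

text \<open>Measures how many letters a push with threshold \<open>c\<close> has to pass. The weights \<open>2 (c - h) - 1\<close> are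
  chosen so that raising one letter by 1 pays for an additional letter of height \<open>c - 1\<close>.\<close>

fun work :: "int \<Rightarrow> (bool \<times> int) list \<Rightarrow> nat" where
  "work c [] = 0"
| "work c ((q, h) # s) = (if h < c then nat (2 * (c - h) - 1) + work c s else 0)"

text \<open>An edge of the Cayley graph has excess \<open>0\<close> iff it belongs to the tree of normal forms. The base
  \<open>4\<close> allows one edge to be replaced by three edges of smaller work.\<close>

definition excess :: "nat \<Rightarrow> nat" where
  "excess k = 4 ^ k - 1"

fun edge_cost :: "state \<Rightarrow> gen \<Rightarrow> nat" where
  "edge_cost (s, n) X = 0"
| "edge_cost (s, n) Xi = 0"
| "edge_cost (s, n) Y = excess (work (threshold True n) s)"
| "edge_cost (s, n) Yi = excess (work (threshold False n) s)"

fun path_cost :: "state \<Rightarrow> gen list \<Rightarrow> nat" where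
  "path_cost st [] = 0"
| "path_cost st (a # w) = edge_cost st a + path_cost (act st a) w"

lemma path_cost_append: "path_cost st (u @ v) = path_cost st u + path_cost (run st u) v"
  by (induction u arbitrary: st) auto

lemma work_stackable: "stackable p m s \<Longrightarrow> work (threshold p m) s = 0"
  by (cases s) auto

lemma work_mono: "c \<le> d \<Longrightarrow> work c s \<le> work d s"
  by (induction c s rule: work.induct) auto

lemma work_less: "c < d \<Longrightarrow> h < c \<Longrightarrow> work c ((e, h) # s) < work d ((e, h) # s)"
  using work_mono[of c d s] by auto

text \<open>Every letter passed rises by 1 and so loses weight 2; the inserted letter has height
  \<open>n\<close> and adds at most 1.\<close>

lemma work_push: "work (n + 1) (push False n s) \<le> work (n + 1) s + 1"
  by (induction False n s rule: push.induct) auto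

lemma work_push_less:
  "h < n - 1 \<Longrightarrow> work (n + 1) (push False n ((e, h) # s)) < work (n + 1) ((e, h) # s)"
  using work_push[of n s] by auto

text \<open>For each letter that the first push passes, the distance to the threshold drops by 2 in
  total. The letter inserted first ends at height \<open>n - sign p\<close>, exactly the new
  threshold, and weighs nothing. If the first push cancels instead, normality controls the letters
  below.\<close>

lemma work_push_push:
  assumes "normal_stack s" "threshold p m = n + 1"
  shows "work (n - sign p) (push p m (push False n s)) \<le> work (n + 1) s"
  using assms
proof (induction s rule: normal_stack.induct)
  case 1
  then show ?case by (cases p) auto
next
  case (2 q h s)
  show ?case
  proof (cases "h < n - 1")
    case True
    then show ?thesis using 2 by (cases p) auto
  next
    case False
    then show ?thesis using 2
      by (cases p; cases q; cases s rule: normal_stack.cases;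
          cases "tl s" rule: normal_stack.cases) auto
  qed
qed

lemma work_push_push_less:
  assumes "normal_stack ((e, h) # s)" "threshold p m = n + 1" "h < n - 1"
  shows "work (n - sign p) (push p m (push False n ((e, h) # s))) < work (n + 1) ((e, h) # s)"
  using work_push_push[of s p m n] assms by (cases p) auto

lemma run_xpow: "run (s, n) (xpow i) = (s, n + int i)"
  by (induction i arbitrary: n) (auto simp: xpow_def)

lemma run_xinvpow: "run (s, n) (xinvpow i) = (s, n - int i)"
  by (induction i arbitrary: n) (auto simp: xinvpow_def)

lemma path_cost_xpow: "path_cost (s, n) (xpow i) = 0"
  by (induction i arbitrary: n) (auto simp: xpow_def)

lemma path_cost_xinvpow: "path_cost (s, n) (xinvpow i) = 0"
  by (induction i arbitrary: n) (auto simp: xinvpow_def)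

lemma act_yletter: "act (s, n) (yletter p) = (push p n s, n)"
  by (cases p) (auto simp: yletter_def)

lemma edge_cost_yletter: "edge_cost (s, n) (yletter p) = excess (work (threshold p n) s)"
  by (cases p) (auto simp: yletter_def)

lemma excess_0: "excess 0 = 0"
  by (simp add: excess_def)

lemma excess_less:
  assumes "a < b"
  shows "excess a < excess b"
proof -
  have "(4::nat) ^ a < 4 ^ b" using assms by (intro power_strict_increasing) auto
  then show ?thesis unfolding excess_def by (intro diff_less_mono) auto
qed

text \<open>With \<open>d = Suc k\<close> the left side is at most \<open>3 * 4 ^ k - 3\<close>,
  which is less than \<open>4 * 4 ^ k - 1\<close>.\<close>

lemma excess_sum3_less:
  assumes "a < d" "b < d" "c < d"
  shows "excess a + (excess b + excess c) < excess d"
proof -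
  obtain k where d: "d = Suc k" using assms(1) by (cases d) auto
  have "(4::nat) ^ j \<le> 4 ^ k" if "j < d" for j
    using that d by (intro power_increasing) auto
  note le = this[OF assms(1)] this[OF assms(2)] this[OF assms(3)]
  have "(4::nat) ^ d = 4 * 4 ^ k" by (simp add: d)
  moreover have "(4::nat) ^ k \<ge> 1" "(4::nat) ^ a \<ge> 1" by simp_all
  ultimately show ?thesis using le unfolding excess_def by linarith
qed

text \<open>The edge labelled \<open>yletter e\<close> lies in the tree before and after the swap
  and costs nothing; the edge labelled \<open>yletter p\<close> no longer has to pass the letter
  \<open>(e, h)\<close>.\<close>

lemma path_cost_swap:
  assumes "normal_stack s" "stackable e h s" "h < threshold p (h + int i)"
    and "int j = int i + sign p"
  shows "path_cost (s, h) (xpow i @ [yletter p] @ xinvpow j @ [yletter e] @ xpow j)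
    < path_cost (s, h) ([yletter e] @ xpow i @ [yletter p])"
proof -
  let ?c = "threshold p (h + int i)"
  have "stackable e (h - sign p) (push p (h + int i) s)"
    using assms stackable_push by blast
  then have "work (threshold e (h - sign p)) (push p (h + int i) s) = 0"
    by (rule work_stackable)
  moreover have "work ?c s < work ?c ((e, h) # s)"
    using assms(3) by simp
  then have "excess (work ?c s) < excess (work ?c ((e, h) # s))"
    by (rule excess_less)
  moreover have hj: "h + int i - int j = h - sign p"
    using assms(4) by simp
  ultimately show ?thesis
    using push_stackable[OF assms(2)] work_stackable[OF assms(2)]
    by (simp add: path_cost_append path_cost_xpow path_cost_xinvpow run_xpow run_xinvpow
        act_yletter edge_cost_yletter excess_0 hj del: threshold.simps work.simps)
qed

text \<open>The replaced edge has threshold \<open>n + 1\<close>. The three new ones have thresholds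
  \<open>n - 1\<close>, \<open>n + 1\<close> and \<open>n - sign p\<close>, the latter two on stacks
  already changed by pushes; each has smaller work because the top letter lies below
  \<open>n - 1\<close>.\<close>

lemma path_cost_long:
  assumes "normal_stack ((e, h) # s)" "h < n - 1"
  shows "path_cost ((e, h) # s, n) [Yi, X, Y, Xi, Xi, Y, X, X]
      < path_cost ((e, h) # s, n) [X, Y]" (is ?thesis1)
    and "path_cost ((e, h) # s, n) [Yi, X, X, Yi, Xi, Y, X]
      < path_cost ((e, h) # s, n) [X, X, Yi]" (is ?thesis2)
proof -
  note less = work_less[of "n - 1" "n + 1" h e s, OF _ assms(2)] work_push_less[OF assms(2), of e s]
  note 1 = excess_sum3_less[OF less work_push_push_less[OF assms(1) _ assms(2), of True "n + 1"]]
  note 2 = excess_sum3_less[OF less work_push_push_less[OF assms(1) _ assms(2), of False "n + 2"]]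
  show ?thesis1 using 1 by (simp del: push.simps work.simps)
  show ?thesis2 using 2 by (simp add: add.commute del: push.simps work.simps)
qed

text \<open>Turns the side condition of the two long rules into the hypothesis of
  \<open>path_cost_long\<close>: unless \<open>n - h \<ge> 2\<close>, the last two letters cannot
  both be \<open>X\<close>.\<close>

lemma word_of_AyAx2:
  assumes "word_of s n \<in> AyAx2"
  obtains e h t where "s = (e, h) # t" "h < n - 1"
proof -
  obtain w1 d w2 where w: "word_of s n = w1 @ [d] @ w2 @ [X, X]" and d: "d \<in> yeps"
    using assms unfolding AyAx2_def by blast
  show ?thesis
  proof (cases s rule: normal_stack.cases)
    case 1
    have "d \<in> set (xpower n)" using w 1 by simp
    then show ?thesis using d by (auto simp: xpower_def yeps_def split: if_splits)
  next
    case (2 e h t)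
    have ends: "word_of t h @ [yletter e] @ xpower (n - h) = (w1 @ [d] @ w2) @ [X, X]"
      using w 2 by simp
    have "h < n - 1"
    proof (rule ccontr)
      assume "\<not> h < n - 1"
      then consider "n - h \<le> - 1" | "n - h = 0" | "n - h = 1" by linarith
      then show False
      proof cases
        case 1
        then have "xpower (n - h) = xpower (n - h + 1) @ [Xi]"
          using xpower_snoc_Xi[of "n - h + 1"] by simp
        then show False using arg_cong[OF ends, of last] by simp
      next
        case 2
        then show False using arg_cong[OF ends, of last]
          by (simp add: xpower_def yletter_def split: if_splits)
      next
        case 3
        then show False using arg_cong[OF ends, of "\<lambda>w. last (butlast w)"]
          by (simp add: xpower_def yletter_def butlast_append split: if_splits)
      qed
    qed
    then show ?thesis using 2 that by blast
  qed
qed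

section \<open>The rules present the group\<close>

lemma congr_context: "(u, v) \<in> congr UNIV S \<Longrightarrow> (l @ u @ r, l @ v @ r) \<in> congr UNIV S"
proof (induction rule: congr.induct)
  case (base p q l' r')
  then show ?case using congr.base[of p q S "l @ l'" UNIV "r' @ r"] by simp
qed (auto intro: congr.intros)

lemma congr_append:
  "(u, u') \<in> congr UNIV S \<Longrightarrow> (v, v') \<in> congr UNIV S \<Longrightarrow> (u @ v, u' @ v') \<in> congr UNIV S"
  using congr_context[of u u' S "[]" v] congr_context[of v v' S u' "[]"] by (auto intro: congr.trans)

lemma congr_mono:
  assumes "S \<subseteq> congr UNIV T"
  shows "congr UNIV S \<subseteq> congr UNIV T"
proof (rule subrelI)
  fix u v assume "(u, v) \<in> congr UNIV S"
  then show "(u, v) \<in> congr UNIV T"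
    by (induction rule: congr.induct) (use assms in \<open>auto intro: congr.intros congr_context\<close>)
qed

lemma congr_incl: "S \<subseteq> congr UNIV S"
  using congr.base[of _ _ S "[]" UNIV "[]"] by auto

section \<open>Identities verified by one relator and free reduction\<close>

fun cancel :: "gen \<Rightarrow> gen list \<Rightarrow> gen list" where
  "cancel a [] = [a]"
| "cancel a (b # w) = (if b = ginv a then w else a # b # w)"

definition free_reduce :: "gen list \<Rightarrow> gen list" where
  "free_reduce w = foldr cancel w []"

lemma congr_free_reduce:
  assumes "\<And>a. ([a, ginv a], []) \<in> congr UNIV S"
  shows "(w, free_reduce w) \<in> congr UNIV S"
proof (induction w)
  case Nil
  then show ?case by (simp add: free_reduce_def congr.refl)
next
  case (Cons a w)
  have "(a # v, cancel a v) \<in> congr UNIV S" for v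
    using congr_context[OF assms[of a], of "[]" "tl v"]
    by (cases v) (auto intro: congr.refl)
  moreover have "(a # w, a # free_reduce w) \<in> congr UNIV S"
    using congr_context[OF Cons, of "[a]" "[]"] by simp
  ultimately show ?case
    unfolding free_reduce_def by (auto intro: congr.trans)
qed

text \<open>A certificate scheme: \<open>A\<close> and \<open>B\<close> are the context in which the
  relation is used once, and the rest is computed free reduction. Below, \<open>congr.sym\<close>
  appears where the relator is inserted into the right-hand word.\<close>

lemma congr_by_relation:
  assumes "\<And>a. ([a, ginv a], []) \<in> congr UNIV S" "(p, q) \<in> congr UNIV S"
    and "free_reduce l = free_reduce (A @ p @ B)" "free_reduce r = free_reduce (A @ q @ B)"
  shows "(l, r) \<in> congr UNIV S"
  using congr_free_reduce[OF assms(1)] congr_context[OF assms(2), of A B] assms(3,4)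
  by (metis congr.sym congr.trans)

lemma congr_F_rels: "([a, ginv a], []) \<in> congr UNIV F_rels"
  "(F_rel1, []) \<in> congr UNIV F_rels" "(F_rel2, []) \<in> congr UNIV F_rels"
  by (rule subsetD[OF congr_incl], force simp: F_rels_def)+

lemmas congr_F_rel1 = congr_by_relation[OF congr_F_rels(1) congr_F_rels(2)]
lemmas congr_F_rel2 = congr_by_relation[OF congr_F_rels(1) congr_F_rels(3)]

lemma congr_commute_Y:
  assumes "e \<in> yeps" "i \<in> {1, 2}"
  shows "([e] @ xpow i @ [Y], xpow i @ [Y] @ xinvpow (i + 1) @ [e] @ xpow (i + 1))
    \<in> congr UNIV F_rels"
proof -
  note defs = free_reduce_def F_rel1_def F_rel2_def xpow_def xinvpow_def numeral_eq_Suc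
  consider "e = Y" "i = 1" | "e = Y" "i = 2" | "e = Yi" "i = 1" | "e = Yi" "i = 2"
    using assms by (auto simp: yeps_def)
  then show ?thesis
  proof cases
    case 1
    then show ?thesis
      by (intro congr_F_rel1[of _ "[X, Y, Xi, Xi, Y]" "[X, X]"]) (simp_all add: defs)
  next
    case 2
    then show ?thesis
      by (intro congr_F_rel2[of _ "[X, X, Y, Xi, Xi, Xi, Y]" "[X, X, X]"]) (simp_all add: defs)
  next
    case 3
    then show ?thesis
      by (intro congr.sym[OF congr_F_rel1[of _ "[X, Y, Xi, Xi]" "[X, X, Yi, Xi, Yi, X, Y]"]])
        (simp_all add: defs)
  next
    case 4
    then show ?thesis
      by (intro congr.sym[OF congr_F_rel2[of _ "[X, X, Y, Xi, Xi, Xi]"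
              "[X, X, X, Yi, Xi, Xi, Yi, X, X, Y]"]]) (simp_all add: defs)
  qed
qed

lemma congr_commute_Yi:
  assumes "e \<in> yeps" "i \<in> {2, 3}"
  shows "([e] @ xpow i @ [Yi], xpow i @ [Yi] @ xinvpow (i - 1) @ [e] @ xpow (i - 1))
    \<in> congr UNIV F_rels"
proof -
  note defs = free_reduce_def F_rel1_def F_rel2_def xpow_def xinvpow_def numeral_eq_Suc
  consider "e = Y" "i = 2" | "e = Y" "i = 3" | "e = Yi" "i = 2" | "e = Yi" "i = 3"
    using assms by (auto simp: yeps_def)
  then show ?thesis
  proof cases
    case 1
    then show ?thesis
      by (intro congr.sym[OF congr_F_rel1[of _ "[Y]" "[X, X, Yi]"]]) (simp_all add: defs)
  next
    case 2
    then show ?thesis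
      by (intro congr.sym[OF congr_F_rel2[of _ "[Y]" "[X, X, X, Yi]"]]) (simp_all add: defs)
  next
    case 3
    then show ?thesis
      by (intro congr_F_rel1[of _ "[]" "[X, X, Yi, Xi, Yi, X]"]) (simp_all add: defs)
  next
    case 4
    then show ?thesis
      by (intro congr_F_rel2[of _ "[]" "[X, X, X, Yi, Xi, Xi, Yi, X, X]"]) (simp_all add: defs)
  qed
qed

text \<open>The right-hand sides arise by inserting \<open>y^-1 y\<close> in front and moving this
  \<open>y\<close> to the right by the short rule with \<open>i = 1\<close>, respectively
  \<open>i = 2\<close>. Each of these rules costs one use of \<open>F_rel1\<close>.\<close>

lemma congr_long:
  "([X, Y], [Yi, X, Y, Xi, Xi, Y, X, X]) \<in> congr UNIV F_rels"
  "([X, X, Yi], [Yi, X, X, Yi, Xi, Y, X]) \<in> congr UNIV F_rels"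
  subgoal
    by (rule congr_F_rel1[of _ "[X, Y, Xi, Xi]" "[X, X, Yi, Xi, Yi, X, Y, Xi, Xi, Y, X, X]"])
      (simp_all add: free_reduce_def F_rel1_def)
  subgoal
    by (rule congr.sym[OF congr_F_rel1[of _ "[]" "[X, X, Yi]"]])
      (simp_all add: free_reduce_def F_rel1_def)
  done

lemma R_F_cases [consumes 1]:
  assumes "(l, r) \<in> R_F"
  obtains (cancel) u a where "l = u @ [a, ginv a]" "r = u"
  | (Y) u p i where "i \<in> {1, 2}" "u @ [yletter p] @ xpow i \<in> NN"
      "l = u @ [yletter p] @ xpow i @ [Y]"
      "r = u @ xpow i @ [Y] @ xinvpow (i + 1) @ [yletter p] @ xpow (i + 1)"
  | (Yi) u p i where "i \<in> {2, 3}" "u @ [yletter p] @ xpow i \<in> NN"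
      "l = u @ [yletter p] @ xpow i @ [Yi]"
      "r = u @ xpow i @ [Yi] @ xinvpow (i - 1) @ [yletter p] @ xpow (i - 1)"
  | (long_Y) u where "u \<in> NN" "u \<in> AyAx2" "l = u @ [X, Y]" "r = u @ [Yi, X, Y, Xi, Xi, Y, X, X]"
  | (long_Yi) u where "u \<in> NN" "u \<in> AyAx2" "l = u @ [X, X, Yi]" "r = u @ [Yi, X, X, Yi, Xi, Y, X]"
proof -
  have yeps: "\<exists>p. e = yletter p" if "e \<in> yeps" for e
    using that by (auto simp: yeps_def yletter_def intro: exI[of _ True] exI[of _ False])
  show ?thesis
    using assms unfolding R_F_def
  proof (elim UnE CollectE exE conjE Pair_inject IntE, goal_cases)
    case (1 u a)
    then show ?thesis using cancel by blast
  next
    case (2 u e i)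
    then show ?thesis using Y yeps by blast
  next
    case (3 u e i)
    then show ?thesis using Yi yeps by blast
  next
    case (4 u)
    then show ?thesis using long_Y by blast
  next
    case (5 u)
    then show ?thesis using long_Yi by blast
  qed
qed

lemma R_F_congr:
  assumes "(l, r) \<in> R_F"
  shows "(l, r) \<in> congr UNIV F_rels"
  using assms
proof (cases rule: R_F_cases)
  case (cancel u a)
  then show ?thesis using congr_context[OF congr_F_rels(1), of u a "[]"] by simp
next
  case (Y u p i)
  then show ?thesis using congr_context[OF congr_commute_Y, of "yletter p" i u "[]"] by simp
next
  case (Yi u p i)
  then show ?thesis using congr_context[OF congr_commute_Yi, of "yletter p" i u "[]"] by simp
next
  case (long_Y u)
  then show ?thesis using congr_context[OF congr_long(1), of u "[]"] by simp
next
  case (long_Yi u)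
  then show ?thesis using congr_context[OF congr_long(2), of u "[]"] by simp
qed

text \<open>Provides the side condition of the rules with empty \<open>u\<close>, from which the
  relators are recovered.\<close>

lemma NN_short: "[yletter p] @ xpow i \<in> NN"
proof -
  have no_tl: "\<not> subword s ([yletter p] @ xpow i)" if x: "x \<in> set (tl s)" "x \<noteq> X" for s x
  proof
    assume "subword s ([yletter p] @ xpow i)"
    then obtain l r where "[yletter p] @ xpow i = l @ s @ r"
      unfolding subword_def by blast
    then have "xpow i = tl l @ s @ r \<or> xpow i = tl s @ r"
      using x(1) by (cases l; cases s) auto
    then have "x \<in> set (xpow i)"
      using x(1) by (cases s) auto
    then show False using x(2) by (simp add: xpow_def)
  qed
  \<comment> \<open>The only forbidden subword whose tail consists of \<open>X\<close> alone, so
    \<open>no_tl\<close> does not cover it.\<close>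
  have no_Xi: "\<not> subword [Xi, X] ([yletter p] @ xpow i)"
  proof
    assume "subword [Xi, X] ([yletter p] @ xpow i)"
    then obtain l r where "[yletter p] @ xpow i = l @ [Xi, X] @ r"
      unfolding subword_def by blast
    from arg_cong[OF this, of "\<lambda>w. Xi \<in> set w"] show False
      by (simp add: xpow_def yletter_def split: if_splits)
  qed
  have "\<not> subword [a, ginv a] ([yletter p] @ xpow i)" for a
    using no_tl[of "ginv a" "[a, ginv a]"] no_Xi by (cases a) simp_all
  moreover have "\<not> subword ([e] @ xpow k @ [Y]) ([yletter p] @ xpow i)" for e k
    by (rule no_tl[of Y]) simp_all
  moreover have "\<not> subword ([e] @ xpow k @ [Yi]) ([yletter p] @ xpow i)" for e k
    by (rule no_tl[of Yi]) simp_all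
  ultimately show ?thesis unfolding NN_def by blast
qed

lemma R_F_I:
  "(u @ [a, ginv a], u) \<in> R_F"
  "e \<in> yeps \<Longrightarrow> i \<in> {1, 2} \<Longrightarrow> u @ [e] @ xpow i \<in> NN \<Longrightarrow>
    (u @ [e] @ xpow i @ [Y], u @ xpow i @ [Y] @ xinvpow (i + 1) @ [e] @ xpow (i + 1)) \<in> R_F"
  "e \<in> yeps \<Longrightarrow> i \<in> {2, 3} \<Longrightarrow> u @ [e] @ xpow i \<in> NN \<Longrightarrow>
    (u @ [e] @ xpow i @ [Yi], u @ xpow i @ [Yi] @ xinvpow (i - 1) @ [e] @ xpow (i - 1)) \<in> R_F"
  "u \<in> NN \<Longrightarrow> u \<in> AyAx2 \<Longrightarrow> (u @ [X, Y], u @ [Yi, X, Y, Xi, Xi, Y, X, X]) \<in> R_F"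
  "u \<in> NN \<Longrightarrow> u \<in> AyAx2 \<Longrightarrow> (u @ [X, X, Yi], u @ [Yi, X, X, Yi, Xi, Y, X]) \<in> R_F"
  unfolding R_F_def by blast+

text \<open>Up to context and free cancellation, the relators are the rules for \<open>Y\<close>
  with \<open>e = Y\<close>, empty \<open>u\<close> and \<open>i = 1\<close>,
  \<open>i = 2\<close>.\<close>

lemma congr_R_F: "congr UNIV R_F = congr UNIV F_rels"
proof
  show "congr UNIV R_F \<subseteq> congr UNIV F_rels"
    using R_F_congr by (intro congr_mono) auto
  have inv: "([a, ginv a], []) \<in> congr UNIV R_F" for a
    by (rule subsetD[OF congr_incl]) (force simp: R_F_def)
  have "([Y] @ xpow i @ [Y], xpow i @ [Y] @ xinvpow (i + 1) @ [Y] @ xpow (i + 1)) \<in> R_F"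
    if "i \<in> {1, 2}" for i
    using R_F_I(2)[OF _ that, of Y "[]"] NN_short[of True i] by (simp add: yletter_def yeps_def)
  note rule = subsetD[OF congr_incl this]
  have "(F_rel1, []) \<in> congr UNIV R_F"
    by (rule congr_by_relation[OF inv rule[of 1], of _ "[Yi, X, X, Yi, Xi]" "[Xi, Xi]"])
      (simp_all add: free_reduce_def F_rel1_def xpow_def xinvpow_def numeral_eq_Suc)
  moreover have "(F_rel2, []) \<in> congr UNIV R_F"
    by (rule congr_by_relation[OF inv rule[of 2], of _ "[Yi, X, X, X, Yi, Xi, Xi]" "[Xi, Xi, Xi]"])
      (simp_all add: free_reduce_def F_rel2_def xpow_def xinvpow_def numeral_eq_Suc)
  ultimately show "congr UNIV F_rels \<subseteq> congr UNIV R_F"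
    using inv by (intro congr_mono) (auto simp: F_rels_def)
qed

section \<open>Termination\<close>

lemma run_NN_snoc:
  assumes "u @ [yletter p] \<in> NN" "run ([], 0) u = (s, n)"
  shows "stackable p n s"
  using assms NN_snoc_stackable word_of_run NN_prefix by metis

text \<open>Free cancellation may leave the cost unchanged, but it shortens the word; all other
  rules lower the cost strictly.\<close>

lemma path_cost_R_F:
  assumes "(l, r) \<in> R_F"
  shows "path_cost ([], 0) r < path_cost ([], 0) l
    \<or> path_cost ([], 0) r \<le> path_cost ([], 0) l \<and> length r < length l"
  using assms
proof (cases rule: R_F_cases)
  case (cancel u a)
  then show ?thesis by (simp add: path_cost_append)
next
  case (Y u p i)
  obtain s n where sn: "run ([], 0) u = (s, n)" by fastforce
  have "normal_stack s" using normal_stack_run[of "([], 0)" u] sn by simp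
  moreover have "stackable p n s" using run_NN_snoc[OF _ sn] NN_prefix Y(2) by (metis append.assoc)
  ultimately show ?thesis
    using path_cost_swap[of s p n True i "i + 1"] Y sn
    by (auto simp: path_cost_append[of _ u] yletter_def[of True])
next
  case (Yi u p i)
  obtain s n where sn: "run ([], 0) u = (s, n)" by fastforce
  have "normal_stack s" using normal_stack_run[of "([], 0)" u] sn by simp
  moreover have "stackable p n s" using run_NN_snoc[OF _ sn] NN_prefix Yi(2) by (metis append.assoc)
  ultimately show ?thesis
    using path_cost_swap[of s p n False i "i - 1"] Yi sn
    by (auto simp: path_cost_append[of _ u] yletter_def[of False])
next
  case (long_Y u)
  obtain s n where sn: "run ([], 0) u = (s, n)" by fastforce
  then have "word_of s n \<in> AyAx2" using word_of_run long_Y by metis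
  then obtain e h t where "s = (e, h) # t" "h < n - 1" by (rule word_of_AyAx2)
  moreover have "normal_stack s" using normal_stack_run[of "([], 0)" u] sn by simp
  ultimately show ?thesis
    using path_cost_long(1)[of e h t n] long_Y sn by (simp add: path_cost_append[of _ u] del: path_cost.simps)
next
  case (long_Yi u)
  obtain s n where sn: "run ([], 0) u = (s, n)" by fastforce
  then have "word_of s n \<in> AyAx2" using word_of_run long_Yi by metis
  then obtain e h t where "s = (e, h) # t" "h < n - 1" by (rule word_of_AyAx2)
  moreover have "normal_stack s" using normal_stack_run[of "([], 0)" u] sn by simp
  ultimately show ?thesis
    using path_cost_long(2)[of e h t n] long_Yi sn by (simp add: path_cost_append[of _ u] del: path_cost.simps)
qed

lemma wf_prefix_step_R_F: "wf {(w', w). prefix_step R_F w w'}"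
proof (rule wf_subset[OF wf_measures])
  show "{(w', w). prefix_step R_F w w'} \<subseteq> measures [path_cost ([], 0), length]"
  proof (rule subrelI)
    fix w' w assume "(w', w) \<in> {(w', w). prefix_step R_F w w'}"
    then obtain l r z where R: "(l, r) \<in> R_F" and w: "w = l @ z" "w' = r @ z"
      by (auto simp: prefix_step_def)
    \<comment> \<open>Both sides represent the same element, so the untouched suffix
      \<open>z\<close> starts from the same state and costs the same.\<close>
    have "run ([], 0) r = run ([], 0) l"
      using run_congr[OF R_F_congr[OF R], of "([], 0)"] by simp
    then show "(w', w) \<in> measures [path_cost ([], 0), length]"
      using path_cost_R_F[OF R] by (auto simp: path_cost_append w)
  qed
qed

section \<open>Irreducible words are normal forms\<close>

lemma prefix_stepI: "(l, r) \<in> R \<Longrightarrow> w = l @ z \<Longrightarrow> \<exists>w'. prefix_step R w w'"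
  unfolding prefix_step_def by blast

lemma AyAx2I: "e \<in> yeps \<Longrightarrow> i \<ge> 2 \<Longrightarrow> u @ [e] @ xpow i \<in> AyAx2"
proof -
  assume "e \<in> yeps" "i \<ge> 2"
  then obtain j where "i = j + 2" using le_Suc_ex[of 2 i] by (auto simp: add.commute)
  then have "u @ [e] @ xpow i = u @ [e] @ xpow j @ [X, X]"
    by (simp add: xpow_def replicate_app_Cons_same)
  then show ?thesis unfolding AyAx2_def using \<open>e \<in> yeps\<close> by blast
qed

lemma xpow_add: "xpow (i + j) = xpow i @ xpow j"
  by (simp add: xpow_def replicate_add)

text \<open>A forbidden subword created by the last letter is a suffix. Exponents beyond the range
  of the short rules fall to the long rules.\<close>

lemma R_F_redex:
  assumes "w \<in> NN" "w @ [a] \<notin> NN"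
  shows "\<exists>r. (w @ [a], r) \<in> R_F"
proof -
  have suffix: "\<exists>u. w @ [a] = u @ s" if s: "subword s (w @ [a])" "\<not> subword s w" for s
  proof -
    obtain u v where "w @ [a] = u @ s @ v" using s(1) unfolding subword_def by blast
    then show ?thesis
      using s(2) unfolding subword_def by (cases v rule: rev_cases) auto
  qed
  have "(\<exists>b. \<not> subword [b, ginv b] w \<and> subword [b, ginv b] (w @ [a]))
      \<or> (\<exists>e\<in>yeps. \<exists>i\<ge>1. \<not> subword ([e] @ xpow i @ [Y]) w
            \<and> subword ([e] @ xpow i @ [Y]) (w @ [a]))
      \<or> (\<exists>e\<in>yeps. \<exists>i\<ge>1. \<not> subword ([e] @ xpow (i + 1) @ [Yi]) w
            \<and> subword ([e] @ xpow (i + 1) @ [Yi]) (w @ [a]))"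
    using assms unfolding NN_def by blast
  then consider (cancel) u b where "w @ [a] = u @ [b, ginv b]"
    | (Y) u e i where "e \<in> yeps" "i \<ge> 1" "w @ [a] = u @ [e] @ xpow i @ [Y]"
    | (Yi) u e i where "e \<in> yeps" "i \<ge> 1" "w @ [a] = u @ [e] @ xpow (i + 1) @ [Yi]"
    using suffix by metis
  then show ?thesis
  proof cases
    case cancel
    then show ?thesis using R_F_I(1) by metis
  next
    case (Y u e i)
    then have w: "w = u @ [e] @ xpow i" by simp
    show ?thesis
    proof (cases "i \<in> {1, 2}")
      case True
      then show ?thesis
        using R_F_I(2)[OF Y(1), of i u] assms(1) unfolding Y(3) unfolding w by blast
    next
      case False
      \<comment> \<open>Here \<open>i \<ge> 3\<close>; splitting off one \<open>X\<close> leaves at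
        least two, so the prefix lies in \<open>AyAx2\<close>.\<close>
      then obtain j where j: "i = j + 1" "j \<ge> 2" using Y(2) by (cases i) auto
      have "(u @ [e] @ xpow j) @ xpow 1 \<in> NN" using assms(1) unfolding w j(1) xpow_add by simp
      then have "u @ [e] @ xpow j \<in> NN" by (rule NN_prefix)
      moreover have "w @ [a] = (u @ [e] @ xpow j) @ [X, Y]"
        unfolding Y(3) j(1) xpow_add by (simp add: xpow_def)
      ultimately show ?thesis
        using R_F_I(4) AyAx2I[OF Y(1) j(2)] by metis
    qed
  next
    case (Yi u e i)
    then have w: "w = u @ [e] @ xpow (i + 1)" by simp
    show ?thesis
    proof (cases "i + 1 \<in> {2, 3}")
      case True
      then show ?thesis
        using R_F_I(3)[OF Yi(1), of "i + 1" u] assms(1) unfolding Yi(3) unfolding w by blast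
    next
      case False
      \<comment> \<open>Now the exponent \<open>i + 1\<close> is at least 4, and two letters
        \<open>X\<close> are split off.\<close>
      then obtain j where j: "i + 1 = j + 2" "j \<ge> 2" using Yi(2) by (cases i) auto
      have "(u @ [e] @ xpow j) @ xpow 2 \<in> NN" using assms(1) unfolding w j(1) xpow_add by simp
      then have "u @ [e] @ xpow j \<in> NN" by (rule NN_prefix)
      moreover have "w @ [a] = (u @ [e] @ xpow j) @ [X, X, Yi]"
        unfolding Yi(3) j(1) xpow_add by (simp add: xpow_def numeral_eq_Suc)
      ultimately show ?thesis
        using R_F_I(5) AyAx2I[OF Yi(1) j(2)] by metis
    qed
  qed
qed

lemma Nil_NN: "[] \<in> NN"
  by (simp add: NN_def subword_def)

text \<open>The shortest prefix outside \<open>NN\<close> is a left-hand side by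
  \<open>R_F_redex\<close>, and rules act on prefixes.\<close>

lemma irreducible_NN:
  assumes "prefix_irreducible R_F w"
  shows "w \<in> NN"
proof (rule ccontr)
  assume "w \<notin> NN"
  then have "\<exists>w'. prefix_step R_F w w'"
  proof (induction w rule: rev_induct)
    case Nil
    then show ?case using Nil_NN by simp
  next
    case (snoc a w)
    show ?case
    proof (cases "w \<in> NN")
      case True
      then obtain r where "(w @ [a], r) \<in> R_F" using R_F_redex snoc.prems by blast
      then show ?thesis by (rule prefix_stepI) simp
    next
      case False
      then obtain l r z where "(l, r) \<in> R_F" "w = l @ z"
        using snoc.IH unfolding prefix_step_def by blast
      then show ?thesis using prefix_stepI[of l r R_F "w @ [a]" "z @ [a]"] by simp
    qed
  qed
  then show False using assms unfolding prefix_irreducible_def by blast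
qed

lemma prefix_step_congr:
  assumes "prefix_step R w w'"
  shows "(w, w') \<in> congr UNIV R"
  using assms congr_incl congr_context[of _ _ R "[]"] unfolding prefix_step_def by fastforce

lemma irreducible_exists:
  assumes "wf {(w', w). prefix_step R w w'}"
  shows "\<exists>w'. (w, w') \<in> congr UNIV R \<and> prefix_irreducible R w'"
proof (induction w rule: wf_induct_rule[OF assms])
  case (1 w)
  show ?case
  proof (cases "prefix_irreducible R w")
    case True
    then show ?thesis using congr.refl[of w UNIV] by auto
  next
    case False
    then obtain w1 where "prefix_step R w w1" unfolding prefix_irreducible_def by blast
    then show ?thesis using 1 prefix_step_congr congr.trans by (metis (mono_tags, lifting) case_prodI mem_Collect_eq)
  qed
qed

section \<open>The presented group\<close>

lemma F_class_eq_iff: "F_class u = F_class v \<longleftrightarrow> (u, v) \<in> congr UNIV F_rels"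
  unfolding F_class_def by (auto intro: congr.intros)

text \<open>The product of \<open>ThompsonF\<close> picks representatives by \<open>SOME\<close>;
  this makes the choice immaterial.\<close>

lemma F_class_some: "F_class (SOME v. v \<in> F_class u) = F_class u"
proof -
  have "(SOME v. v \<in> F_class u) \<in> F_class u"
    by (rule someI[of _ u]) (simp add: F_class_def congr.refl)
  then show ?thesis unfolding F_class_eq_iff by (simp add: F_class_def congr.sym)
qed

lemma F_class_mult: "F_class u \<otimes>\<^bsub>ThompsonF\<^esub> F_class v = F_class (u @ v)"
  using F_class_some by (simp add: ThompsonF_def F_class_eq_iff congr_append)

lemma carrier_ThompsonF: "carrier ThompsonF = range F_class"
  by (simp add: ThompsonF_def)

lemma one_ThompsonF: "\<one>\<^bsub>ThompsonF\<^esub> = F_class []"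
  by (simp add: ThompsonF_def)

lemma eval_word_F_gen: "eval_word ThompsonF F_gen w = F_class w"
  by (induction w) (auto simp: eval_word_def one_ThompsonF F_gen_def F_class_mult)

lemma ginv_ginv: "ginv (ginv a) = a"
  by (cases a) auto

lemma congr_inverse_word: "(map ginv (rev w) @ w, []) \<in> congr UNIV F_rels"
proof (induction w)
  case (Cons a w)
  have "([ginv a, a], []) \<in> congr UNIV F_rels"
    using congr_F_rels(1)[of "ginv a"] by (simp add: ginv_ginv)
  from congr_context[OF this, of "map ginv (rev w)" w] show ?case
    using Cons by (auto intro: congr.trans)
qed (simp add: congr.refl)

lemma group_ThompsonF: "group ThompsonF"
proof (rule groupI)
  fix x assume "x \<in> carrier ThompsonF"
  then obtain w where "x = F_class w" by (auto simp: carrier_ThompsonF)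
  then have "F_class (map ginv (rev w)) \<otimes>\<^bsub>ThompsonF\<^esub> x = \<one>\<^bsub>ThompsonF\<^esub>"
    by (simp add: F_class_mult one_ThompsonF F_class_eq_iff congr_inverse_word)
  then show "\<exists>y\<in>carrier ThompsonF. y \<otimes>\<^bsub>ThompsonF\<^esub> x = \<one>\<^bsub>ThompsonF\<^esub>"
    by (auto simp: carrier_ThompsonF)
qed (auto simp: carrier_ThompsonF one_ThompsonF F_class_mult)

text \<open>Normal forms exist by termination; they are unique because irreducible words lie in
  \<open>NN\<close>, where congruent words are equal.\<close>

lemma bounded_regular_CPRS_R_F: "bounded_regular_CPRS ThompsonF UNIV F_gen R_F"
proof -
  have "presents_monoid ThompsonF UNIV F_gen R_F"
    unfolding presents_monoid_def
    by (simp add: eval_word_F_gen carrier_ThompsonF F_class_eq_iff congr_R_F)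
      (auto simp: F_gen_def)
  moreover have "\<exists>!w. w \<in> lists UNIV \<and> prefix_irreducible R_F w \<and> eval_word ThompsonF F_gen w = g"
    if carrier: "g \<in> carrier ThompsonF" for g
  proof -
    obtain u where g: "g = F_class u" using carrier by (auto simp: carrier_ThompsonF)
    obtain w where "(u, w) \<in> congr UNIV R_F" "prefix_irreducible R_F w"
      using irreducible_exists[OF wf_prefix_step_R_F] by blast
    then show ?thesis
      by (intro ex1I[of _ w])
        (auto simp: eval_word_F_gen g F_class_eq_iff congr_R_F
          intro: congr.sym congr.trans NN_unique irreducible_NN)
  qed
  ultimately show ?thesis
    unfolding bounded_regular_CPRS_def is_CPRS_def
    using wf_prefix_step_R_F bounded_RS_R_F sync_regular_R_F by blast
qed

section \<open>Renaming the alphabet\<close>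

text \<open>The alphabet in \<open>autostackable\<close> consists of naturals, so the system over
  \<open>gen\<close> is carried along an injection, with a left inverse for the way back.\<close>

locale renaming =
  fixes enc :: "'g \<Rightarrow> 'h" and dec :: "'h \<Rightarrow> 'g"
  assumes dec_enc: "dec (enc a) = a"
begin

definition ren :: "('g list \<times> 'g list) set \<Rightarrow> ('h list \<times> 'h list) set" where
  "ren R = (\<lambda>(u, v). (map enc u, map enc v)) ` R"

lemma map_dec_enc: "map dec (map enc w) = w"
  by (simp add: comp_def dec_enc)

lemma map_enc_eq_iff: "map enc u = map enc v \<longleftrightarrow> u = v"
  using map_dec_enc by metis

lemma inj_enc: "inj enc"
  by (metis dec_enc injI)

lemma lists_range_enc: "lists (range enc) = range (map enc)"
  by (simp add: lists_image)

lemma ren_iff: "(map enc u, map enc v) \<in> ren R \<longleftrightarrow> (u, v) \<in> R"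
  by (auto simp: ren_def map_enc_eq_iff)

lemma eval_word_ren: "eval_word G (iota \<circ> dec) (map enc w) = eval_word G iota w"
  by (induction w) (auto simp: eval_word_def dec_enc)

lemma congr_ren: "(u, v) \<in> congr UNIV R \<Longrightarrow> (map enc u, map enc v) \<in> congr (range enc) (ren R)"
proof (induction rule: congr.induct)
  case (base p q l r)
  then show ?case
    using congr.base[of "map enc p" "map enc q" "ren R" "map enc l" "range enc" "map enc r"]
    by (simp add: ren_iff lists_range_enc)
next
  case (refl w)
  show ?case by (rule congr.refl) (simp only: lists_range_enc rangeI)
qed (auto intro: congr.intros)

lemma congr_unren: "(u, v) \<in> congr (range enc) (ren R) \<Longrightarrow> (map dec u, map dec v) \<in> congr UNIV R"
proof (induction rule: congr.induct)
  case (base p q l r)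
  then obtain p' q' where "p = map enc p'" "q = map enc q'" "(p', q') \<in> R"
    by (auto simp: ren_def)
  then show ?case
    using congr.base[of p' q' R "map dec l" UNIV "map dec r"] by (simp add: comp_def dec_enc)
qed (auto intro: congr.intros)

lemma congr_ren_iff: "(map enc u, map enc v) \<in> congr (range enc) (ren R) \<longleftrightarrow> (u, v) \<in> congr UNIV R"
  using congr_ren congr_unren[of "map enc u" "map enc v"] by (auto simp only: map_dec_enc)

lemma prefix_step_unren: "prefix_step (ren R) w w' \<Longrightarrow> prefix_step R (map dec w) (map dec w')"
  by (auto simp: prefix_step_def ren_def comp_def dec_enc) blast

lemma prefix_irreducible_ren: "prefix_irreducible (ren R) (map enc w) \<longleftrightarrow> prefix_irreducible R w"
proof -
  have "prefix_step (ren R) (map enc w) (map enc w')" if "prefix_step R w w'" for w'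
    using that ren_iff unfolding prefix_step_def by (metis map_append)
  moreover have "prefix_step R w (map dec w')" if "prefix_step (ren R) (map enc w) w'" for w'
    using prefix_step_unren[OF that] by (simp only: map_dec_enc)
  ultimately show ?thesis unfolding prefix_irreducible_def by blast
qed

lemma pad_pair_ren:
  "pad_pair (map enc u) (map enc v)
    = map (map_prod (map_option enc) (map_option enc)) (pad_pair u v)"
proof -
  have "map Some (map enc w) @ replicate k None
      = map (map_option enc) (map Some w @ replicate k None)" for w k
    by simp
  then show ?thesis
    unfolding pad_pair_def length_map by (simp only: zip_map_map map_prod_def)
qed

lemma sync_regular_ren:
  assumes "sync_regular R"
  shows "sync_regular (ren R)"
proof -
  have "pad_lang (ren R) = map (map_prod (map_option enc) (map_option enc)) ` pad_lang R"
    by (simp add: pad_lang_def ren_def image_image pad_pair_ren case_prod_unfold)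
  moreover have "inj (map_prod (map_option enc) (map_option enc))"
    by (intro prod.inj_map option.inj_map inj_enc)
  ultimately show ?thesis
    using assms by (simp add: sync_regular_pad_lang fsa_accepted_map)
qed

lemma bounded_RS_ren:
  assumes "bounded_RS R"
  shows "bounded_RS (ren R)"
proof -
  obtain K :: nat where K: "K > 0" and bound: "\<forall>(u, v) \<in> R.
      \<exists>w u' v'. u = w @ u' \<and> v = w @ v' \<and> length u' + length v' \<le> K"
    using assms unfolding bounded_RS_def by (elim exE conjE) (rule that)
  have "\<exists>w u' v'. u = w @ u' \<and> v = w @ v' \<and> length u' + length v' \<le> K"
    if ren: "(u, v) \<in> ren R" for u v
  proof -
    obtain u0 v0 where "(u0, v0) \<in> R" and uv: "u = map enc u0" "v = map enc v0"
      using ren by (auto simp: ren_def)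
    then obtain w u' v' where "u0 = w @ u'" "v0 = w @ v'" "length u' + length v' \<le> K"
      using bspec[OF bound, of "(u0, v0)"] by auto
    then show ?thesis using uv
      by (intro exI[of _ "map enc w"] exI[of _ "map enc u'"] exI[of _ "map enc v'"]) simp
  qed
  then show ?thesis using K unfolding bounded_RS_def by blast
qed

lemma presents_monoid_ren:
  assumes "presents_monoid G UNIV iota R"
  shows "presents_monoid G (range enc) (iota \<circ> dec) (ren R)"
  using assms unfolding presents_monoid_def lists_range_enc
  by (auto simp: eval_word_ren congr_ren_iff image_image dec_enc) (auto simp: ren_def)

lemma is_CPRS_ren:
  assumes "is_CPRS G UNIV iota R"
  shows "is_CPRS G (range enc) (iota \<circ> dec) (ren R)"
proof -
  have wf: "wf {(w', w). prefix_step R w w'}"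
    using assms by (simp add: is_CPRS_def)
  have "wf {(w', w). prefix_step (ren R) w w'}"
    by (rule wf_subset[OF wf_inv_image[OF wf, of "map dec"]])
      (auto simp: inv_image_def prefix_step_unren)
  moreover have "\<exists>!w. w \<in> lists (range enc) \<and> prefix_irreducible (ren R) w
      \<and> eval_word G (iota \<circ> dec) w = g" if "g \<in> carrier G" for g
  proof -
    have "\<exists>!w. prefix_irreducible R w \<and> eval_word G iota w = g"
      using assms that by (simp add: is_CPRS_def)
    then obtain w where w: "prefix_irreducible R w \<and> eval_word G iota w = g"
      and unique: "\<forall>v. prefix_irreducible R v \<and> eval_word G iota v = g \<longrightarrow> v = w"
      by (elim ex1E) (rule that)
    show ?thesis
    proof (rule ex1I[of _ "map enc w"])
      show "map enc w \<in> lists (range enc) \<and> prefix_irreducible (ren R) (map enc w)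
          \<and> eval_word G (iota \<circ> dec) (map enc w) = g"
        using w by (simp only: lists_range_enc prefix_irreducible_ren eval_word_ren rangeI simp_thms)
    next
      fix v assume v: "v \<in> lists (range enc) \<and> prefix_irreducible (ren R) v
          \<and> eval_word G (iota \<circ> dec) v = g"
      then obtain v' where v': "v = map enc v'" unfolding lists_range_enc by blast
      show "v = map enc w"
        using v unique unfolding v' prefix_irreducible_ren eval_word_ren by blast
    qed
  qed
  ultimately show ?thesis
    using assms presents_monoid_ren by (auto simp: is_CPRS_def)
qed

lemma bounded_regular_CPRS_ren:
  "bounded_regular_CPRS G UNIV iota R \<Longrightarrow> bounded_regular_CPRS G (range enc) (iota \<circ> dec) (ren R)"
  by (simp add: bounded_regular_CPRS_def is_CPRS_ren bounded_RS_ren sync_regular_ren)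

end

theorem theorem1p1:
  shows "autostackable ThompsonF \<and> bounded_regular_CPRS ThompsonF UNIV F_gen R_F"
proof -
  obtain enc :: "gen \<Rightarrow> nat" where inj: "inj enc"
    using finite_imp_inj_to_nat_seg[OF finite_gen] by blast
  then interpret renaming enc "inv_into UNIV enc"
    by unfold_locales (simp add: inj)
  have "finite (range enc)" using finite_gen by blast
  then show ?thesis
    unfolding autostackable_def
    using group_ThompsonF bounded_regular_CPRS_R_F bounded_regular_CPRS_ren by blast
qed

end
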